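(* (1) The set of codes for closed $\sigma$-compact sets, i.e. $\{T\in\mathrm{Tree}_\omega : [T]\text{ is }\sigma\text{-compact}\}$, is a $\mathbf{\Pi}_1^1$-complete subset of $\mathrm{Tree}_\omega$. (2) The set of codes for closed not strongly dominating sets, i.e. $\{T\in\mathrm{Tree}_\omega : [T]\text{ is not strongly dominating}\}$, is a $\mathbf{\Pi}_1^1$-complete subset of $\mathrm{Tree}_\omega$.
   Context: A tree over $\omega$ is a set $T\subseteq\omega^{<\omega}$ closed under initial segments. $\mathrm{Tree}_\omega$ is the set of all trees over $\omega$, a Polish space as a $G_\delta$ subset of $\mathcal{P}(\omega^{<\omega})\cong 2^{\omega^{<\omega}}$ (product topology). The body of $T$ is $[T]=\{x\in\omega^\omega : (\forall n)\ x\upharpoonright n\in T\}$; $T$ is regarded as a code for the closed set $[T]\subseteq\omega^\omega$. A set $A\subseteq\omega^\omega$ is strongly dominating if for every $f:\omega^{<\omega}\to\omega$ there is $x\in A$ such that $x(n)\ge f(x\upharpoonright n)$ for all but finitely many $n\in\omega$. Completeness: for Polish spaces $\mathcal{X},\mathcal{Y}$ and $A\subseteq\mathcal{X}$, $B\subseteq\mathcal{Y}$, $B$ is Borel reducible to $A$ if there is a Borel function $f:\mathcal{Y}\to\mathcal{X}$ with $f^{-1}[A]=B$. $A\subseteq\mathcal{X}$ is $\mathbf{\Sigma}_1^1$-complete if $A$ is analytic and for every Polish space $\mathcal{Y}$ every analytic $B\subseteq\mathcal{Y}$ is Borel reducible to $A$. $A\subseteq\mathcal{X}$ is $\mathbf{\Pi}_1^1$-complete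 if $\mathcal{X}\setminus A$ is $\mathbf{\Sigma}_1^1$-complete. *)

theory Defs
  imports "HOL-Analysis.Analysis" "HOL-Library.Sublist"
begin

section \<open>Polish spaces, Borel maps and analytic sets\<close>

definition Polish_space :: "'a topology \<Rightarrow> bool" where
  "Polish_space X \<longleftrightarrow> completely_metrizable_space X \<and> second_countable X"

definition borel_of :: "'a topology \<Rightarrow> 'a measure" where
  "borel_of X = sigma (topspace X) {U. openin X U}"

text \<open>
  A set is analytic if it is a continuous image of some Polish space (possibly the empty one).
  The type of the underlying set of that space has to be fixed. Every Polish space has at most
  continuum many points, so up to homeomorphism it lives on a subset of
  \<^typ>\<open>nat \<Rightarrow> nat\<close>, and nothing is lost by that choice; see
  \<open>analytic_in_continuous_image\<close> below.
\<close>

definition analytic_in :: "'a topology \<Rightarrow> 'a set \<Rightarrow> bool" where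
  "analytic_in X A \<longleftrightarrow>
     (\<exists>(P :: (nat \<Rightarrow> nat) topology) f. Polish_space P \<and> continuous_map P X f \<and> f ` topspace P = A)"

lemma Polish_space_homeomorphic:
  assumes "X homeomorphic_space Y" shows "Polish_space X \<longleftrightarrow> Polish_space Y"
  using homeomorphic_completely_metrizable_space[OF assms]
    homeomorphic_space_second_countability[OF assms]
  unfolding Polish_space_def by blast

lemma Polish_space_inj_nat_fun:
  assumes "Polish_space Y"
  obtains e :: "'b \<Rightarrow> nat \<Rightarrow> nat" where "inj_on e (topspace Y)"
proof -
  obtain \<B> where B: "countable \<B>" "\<And>U x. openin Y U \<Longrightarrow> x \<in> U \<Longrightarrow> \<exists>V\<in>\<B>. x \<in> V \<and> V \<subseteq> U"
  proof -
    have "second_countable Y" using assms by (simp add: Polish_space_def)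
    then show thesis unfolding second_countable_def using that by (elim exE conjE) blast
  qed
  have t0: "t0_space Y"
    using assms unfolding Polish_space_def
    by (elim conjE) (rule Hausdorff_imp_t0_space, rule metrizable_imp_Hausdorff_space,
        rule completely_metrizable_imp_metrizable_space)
  define b where "b = from_nat_into \<B>"
  define e where "e x n = (if x \<in> b n then 1 else 0 :: nat)" for x n
  have "x = y" if xy: "x \<in> topspace Y" "y \<in> topspace Y" "e x = e y" for x y
  proof (rule ccontr)
    assume "x \<noteq> y"
    then obtain U where U: "openin Y U" "x \<notin> U \<longleftrightarrow> y \<in> U"
      using t0 xy unfolding t0_space_def by blast
    then obtain V where V: "V \<in> \<B>" "x \<notin> V \<longleftrightarrow> y \<in> V"
    proof (cases "x \<in> U")
      case True
      with B(2)[OF U(1) True] U(2) that show ?thesis by blast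
    next
      case False
      with U(2) have "y \<in> U" by simp
      with B(2)[OF U(1) this] False that show ?thesis by blast
    qed
    obtain n where n: "b n = V"
      unfolding b_def using from_nat_into_surj[OF B(1) V(1)] by blast
    have "e x n = e y n" using xy(3) by simp
    then show False
      using V(2) by (cases "x \<in> V"; cases "y \<in> V") (simp_all add: e_def n)
  qed
  then have "inj_on e (topspace Y)" by (auto simp: inj_on_def)
  then show thesis by (rule that)
qed

lemma analytic_in_continuous_image:
  fixes Y :: "'b topology"
  assumes Y: "Polish_space Y" and f: "continuous_map Y X f"
  shows "analytic_in X (f ` topspace Y)"
proof -
  obtain e :: "'b \<Rightarrow> nat \<Rightarrow> nat" where e: "inj_on e (topspace Y)"
    using Polish_space_inj_nat_fun[OF Y] .
  define g where "g = the_inv_into (topspace Y) e"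
  define P where "P = pullback_topology (e ` topspace Y) g Y"
  have ge: "g (e y) = y" if "y \<in> topspace Y" for y
    using e that by (simp add: g_def the_inv_into_f_f)
  have tP: "topspace P = e ` topspace Y"
    unfolding P_def topspace_pullback_topology using ge by auto
  have g: "continuous_map P Y g"
    unfolding P_def using continuous_map_pullback[OF continuous_map_id] by simp
  have "continuous_map Y P e"
    unfolding P_def
  proof (rule continuous_map_pullback')
    show "continuous_map Y Y (g \<circ> e)"
      by (rule continuous_map_eq[OF continuous_map_id]) (simp add: ge)
  qed auto
  then have "homeomorphic_maps P Y g e"
    using g ge tP by (auto simp: homeomorphic_maps_def)
  then have "Polish_space P"
    using Y Polish_space_homeomorphic homeomorphic_space_def by blast
  moreover have "continuous_map P X (f \<circ> g)"
    using g f by (rule continuous_map_compose)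
  moreover have "(f \<circ> g) ` topspace P = f ` topspace Y"
    unfolding tP image_image by (rule image_cong) (simp_all add: ge)
  ultimately show ?thesis
    unfolding analytic_in_def by blast
qed

definition Borel_reducible :: "'b topology \<Rightarrow> 'b set \<Rightarrow> 'a topology \<Rightarrow> 'a set \<Rightarrow> bool" where
  "Borel_reducible Y B X A \<longleftrightarrow>
     (\<exists>f. f \<in> borel_of Y \<rightarrow>\<^sub>M borel_of X \<and> f -` A \<inter> topspace Y = B)"

text \<open>
  A definition cannot quantify over types, so the type \<^typ>\<open>'b\<close> carrying the Polish spaces that
  are reduced from is a parameter; completeness in the usual sense is the statement for
  arbitrary \<^typ>\<open>'b\<close>.
\<close>

definition Sigma11_complete :: "'b itself \<Rightarrow> 'a topology \<Rightarrow> 'a set \<Rightarrow> bool" where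
  "Sigma11_complete (_ :: 'b itself) X A \<longleftrightarrow>
     Polish_space X \<and> A \<subseteq> topspace X \<and> analytic_in X A \<and>
     (\<forall>(Y :: 'b topology) B. Polish_space Y \<and> B \<subseteq> topspace Y \<and> analytic_in Y B
        \<longrightarrow> Borel_reducible Y B X A)"

definition Pi11_complete :: "'b itself \<Rightarrow> 'a topology \<Rightarrow> 'a set \<Rightarrow> bool" where
  "Pi11_complete (t :: 'b itself) X A \<longleftrightarrow>
     A \<subseteq> topspace X \<and> Sigma11_complete t X (topspace X - A)"


section \<open>Trees over the natural numbers\<close>

definition Tree :: "nat list set set" where
  "Tree = {T. \<forall>s t. t \<in> T \<and> prefix s t \<longrightarrow> s \<in> T}"

text \<open>The power set of the finite sequences, identified with the product of discrete two-point
  spaces through characteristic functions.\<close>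

definition powerset_space :: "nat list set topology" where
  "powerset_space =
     pullback_topology UNIV (\<lambda>T s. s \<in> T) (product_topology (\<lambda>_. discrete_topology UNIV) UNIV)"

definition Tree_space :: "nat list set topology" where
  "Tree_space = subtopology powerset_space Tree"

definition restr :: "(nat \<Rightarrow> nat) \<Rightarrow> nat \<Rightarrow> nat list"  (infixl "\<restriction>" 90) where
  "x \<restriction> n = map x [0..<n]"

definition body :: "nat list set \<Rightarrow> (nat \<Rightarrow> nat) set" where
  "body T = {x. \<forall>n. x \<restriction> n \<in> T}"

definition sigma_compact :: "'a::topological_space set \<Rightarrow> bool" where
  "sigma_compact A \<longleftrightarrow> (\<exists>K :: nat \<Rightarrow> 'a set. (\<forall>n. compact (K n)) \<and> A = (\<Union>n. K n))"

definition strongly_dominating :: "(nat \<Rightarrow> nat) set \<Rightarrow> bool" where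
  "strongly_dominating A \<longleftrightarrow>
     (\<forall>f :: nat list \<Rightarrow> nat. \<exists>x\<in>A. \<forall>\<^sub>F n in sequentially. x n \<ge> f (x \<restriction> n))"

end

theory Submission
  imports Defs
begin

text \<open>Both complements have the form: \<open>T\<close> contains a nonempty set of nodes each of which splits
  infinitely often, either into direct successors (Laver trees, for strong domination) or into
  initial segments of further members (superperfect trees, for non-\<open>\<sigma>\<close>-compactness). Being such a
  set of nodes is a \<open>G\<^sub>\<delta>\<close> condition, so its projection to the trees is analytic. Conversely, an
  analytic set is given by a Suslin scheme of closed sets, which assigns to every point a tree that
  is ill-founded precisely for the members of the set. Replacing the body \<open>[S]\<close> of that tree by
  \<open>[S] \<times> \<omega>\<^sup>\<omega>\<close> makes it empty outside the set and lets it contain a Laver tree inside, so a single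
  reduction serves both statements.\<close>

section \<open>The Polish space of trees\<close>

text \<open>For finite \<open>A\<close> these are the basic clopen sets of the product
  topology.\<close>

definition cell :: "'a set \<Rightarrow> 'a set \<Rightarrow> 'a set set" where
  "cell A S = {S'. S' \<inter> A = S \<inter> A}"

lemma in_cell_iff: "S' \<in> cell A S \<longleftrightarrow> (\<forall>s\<in>A. s \<in> S' \<longleftrightarrow> s \<in> S)"
  unfolding cell_def by blast

text \<open>A basic open set of the product constrains finitely many coordinates, each of them
  discrete. Openness proofs below thereby reduce to naming finitely many nodes that decide a
  condition.\<close>

lemma openin_powerset_space:
  "openin powerset_space U \<longleftrightarrow> (\<forall>S\<in>U. \<exists>A. finite A \<and> cell A S \<subseteq> U)" (is "?lhs \<longleftrightarrow> ?rhs")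
proof
  assume ?lhs
  then obtain V where V: "openin (product_topology (\<lambda>_. discrete_topology UNIV) UNIV) V"
    and U: "U = (\<lambda>S s. s \<in> S) -` V"
    unfolding powerset_space_def openin_pullback_topology by auto
  show ?rhs
  proof
    fix S assume "S \<in> U"
    then have "(\<lambda>s. s \<in> S) \<in> V" using U by simp
    from V[unfolded openin_product_topology_alt, rule_format, OF this]
    obtain W where W: "finite {s \<in> UNIV. W s \<noteq> topspace (discrete_topology UNIV)}"
      "(\<lambda>s. s \<in> S) \<in> Pi\<^sub>E UNIV W" "Pi\<^sub>E UNIV W \<subseteq> V"
      by (elim exE conjE)
    have mem: "(s \<in> S) \<in> W s" for s using PiE_mem[OF W(2), of s] by simp
    have "cell {s. W s \<noteq> UNIV} S \<subseteq> U"
    proof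
      fix S' assume S': "S' \<in> cell {s. W s \<noteq> UNIV} S"
      have "(s \<in> S') \<in> W s" for s
      proof (cases "W s = UNIV")
        case False
        then have "s \<in> S' \<longleftrightarrow> s \<in> S" using S' by (simp add: in_cell_iff)
        then show ?thesis using mem[of s] by simp
      qed simp
      then have "(\<lambda>s. s \<in> S') \<in> Pi\<^sub>E UNIV W" by (intro PiE_I) simp_all
      then show "S' \<in> U" using W(3) U by blast
    qed
    then show "\<exists>A. finite A \<and> cell A S \<subseteq> U"
      using W(1) by (intro exI[of _ "{s. W s \<noteq> UNIV}"]) simp
  qed
next
  assume R: ?rhs
  let ?V = "{h. {s. h s} \<in> U}"
  have "openin (product_topology (\<lambda>_. discrete_topology UNIV) UNIV) ?V"
    unfolding openin_product_topology_alt
  proof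
    fix h assume "h \<in> ?V"
    then obtain A where A: "finite A" "cell A {s. h s} \<subseteq> U"
      using R by auto
    let ?W = "\<lambda>s. if s \<in> A then {h s} else UNIV"
    have "{s. ?W s \<noteq> UNIV} \<subseteq> A" by (simp add: subset_iff)
    then have "finite {s. ?W s \<noteq> UNIV}" using A(1) by (rule finite_subset)
    moreover have "Pi\<^sub>E UNIV ?W \<subseteq> ?V"
    proof
      fix g assume g: "g \<in> Pi\<^sub>E UNIV ?W"
      have "g s = h s" if "s \<in> A" for s
        using PiE_mem[OF g, of s] that by simp
      then have "{s. g s} \<in> cell A {s. h s}" by (simp add: in_cell_iff)
      then show "g \<in> ?V" using A(2) by auto
    qed
    moreover have "h \<in> Pi\<^sub>E UNIV ?W" by (rule PiE_I) simp_all
    ultimately show "\<exists>W. finite {i \<in> UNIV. W i \<noteq> topspace (discrete_topology UNIV)} \<and>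
      (\<forall>i\<in>UNIV. openin (discrete_topology UNIV) (W i)) \<and> h \<in> Pi\<^sub>E UNIV W \<and> Pi\<^sub>E UNIV W \<subseteq> ?V"
      by (intro exI[of _ ?W]) simp
  qed
  moreover have "U = (\<lambda>S s. s \<in> S) -` ?V \<inter> UNIV" by simp
  ultimately show ?lhs
    unfolding powerset_space_def openin_pullback_topology by blast
qed

lemma openin_powerset_spaceE:
  assumes "openin powerset_space U" "S \<in> U"
  obtains A where "finite A" "cell A S \<subseteq> U"
  using assms unfolding openin_powerset_space by (elim ballE exE conjE) auto

lemma openin_powerset_spaceI:
  assumes "\<And>S. S \<in> U \<Longrightarrow> \<exists>A. finite A \<and> cell A S \<subseteq> U"
  shows "openin powerset_space U"
  using assms by (simp add: openin_powerset_space)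

lemma openin_cell: "finite A \<Longrightarrow> openin powerset_space (cell A S)"
  by (rule openin_powerset_spaceI) (auto simp: cell_def)

lemma topspace_powerset_space [simp]: "topspace powerset_space = UNIV"
  by (simp add: powerset_space_def topspace_pullback_topology)

lemma topspace_Tree_space [simp]: "topspace Tree_space = Tree"
  by (simp add: Tree_space_def)

text \<open>A cell depends only on the trace of \<open>S\<close> on \<open>A\<close>, so finite
  \<open>S\<close> suffice; this makes the base countable.\<close>

definition cells :: "nat list set set set" where
  "cells = (\<lambda>(A, S). cell A S) ` (Collect finite \<times> Collect finite)"

lemma countable_cells: "countable cells"
proof -
  have "countable (Collect finite :: nat list set set)"
    using countable_Collect_finite_subset[of "UNIV :: nat list set"] by simp
  then show ?thesis unfolding cells_def by (intro countable_image countable_SIGMA)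
qed

lemma cellsE:
  assumes "V \<in> cells" obtains A S where "finite A" "V = cell A S"
  using assms by (auto simp: cells_def)

lemma cells_base:
  assumes "openin powerset_space U" "S \<in> U" obtains V where "V \<in> cells" "S \<in> V" "V \<subseteq> U"
proof -
  obtain A where A: "finite A" "cell A S \<subseteq> U" using assms by (rule openin_powerset_spaceE)
  have "cell A S = cell A (S \<inter> A)" by (simp add: cell_def Int_assoc)
  then have "cell A S \<in> cells"
    unfolding cells_def using A(1) by (intro image_eqI[of _ _ "(A, S \<inter> A)"]) simp_all
  moreover have "S \<in> cell A S" by (simp add: cell_def)
  ultimately show thesis using A(2) by (rule that)
qed

text \<open>Characteristic functions give a homeomorphism with a countable product of discrete
  spaces, which yields complete metrizability; the cells are a countable base.\<close>

lemma Polish_powerset_space: "Polish_space powerset_space"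
proof -
  let ?P = "product_topology (\<lambda>_ :: nat list. discrete_topology (UNIV :: bool set)) UNIV"
  let ?i = "\<lambda>(S :: nat list set) s. s \<in> S"
  have i: "continuous_map powerset_space ?P ?i"
    unfolding powerset_space_def using continuous_map_pullback[OF continuous_map_id, where f = ?i]
    by (simp only: id_comp)
  have "?i \<circ> Collect = id" by (simp add: fun_eq_iff)
  then have "continuous_map ?P powerset_space Collect"
    unfolding powerset_space_def by (intro continuous_map_pullback') simp_all
  with i have "homeomorphic_maps powerset_space ?P ?i Collect"
    by (simp add: homeomorphic_maps_def)
  then have "powerset_space homeomorphic_space ?P"
    unfolding homeomorphic_space_def by blast
  moreover have "completely_metrizable_space ?P"
    by (simp add: completely_metrizable_space_product_topology
        completely_metrizable_space_discrete_topology)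
  ultimately have "completely_metrizable_space powerset_space"
    using homeomorphic_completely_metrizable_space by blast
  moreover have "second_countable powerset_space"
    unfolding second_countable_def
  proof (intro exI[of _ cells] conjI ballI allI impI countable_cells)
    show "openin powerset_space V" if "V \<in> cells" for V
      using that by (elim cellsE) (simp add: openin_cell)
    show "\<exists>V\<in>cells. S \<in> V \<and> V \<subseteq> U" if "openin powerset_space U \<and> S \<in> U" for U S
    proof -
      from that have "openin powerset_space U" "S \<in> U" by simp_all
      then obtain V where "V \<in> cells" "S \<in> V" "V \<subseteq> U" by (rule cells_base)
      then show ?thesis by (intro bexI[of _ V] conjI)
    qed
  qed
  ultimately show ?thesis by (simp add: Polish_space_def)
qed

text \<open>Such an intersection is a \<open>G\<^sub>\<delta>\<close>, and these subspaces of Polish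
  spaces are Polish. It serves both for the trees and for the space coding pairs
  \<open>(T, H)\<close>.\<close>

lemma Polish_space_countable_Inter:
  assumes X: "Polish_space X" and I: "countable I" and U: "\<And>i. i \<in> I \<Longrightarrow> openin X (U i)"
  shows "Polish_space (subtopology X (topspace X \<inter> (\<Inter>i\<in>I. U i)))"
proof -
  have "gdelta_in X (\<Inter>(insert (topspace X) (U ` I)))"
    using I U by (intro gdelta_in_Inter) (auto simp: open_imp_gdelta_in)
  then show ?thesis
    using X unfolding Polish_space_def
    by (simp add: completely_metrizable_space_gdelta_in second_countable_subtopology)
qed

lemma Polish_Tree_space: "Polish_space Tree_space"
proof -
  \<comment> \<open>Being a tree is split into one condition per pair of nodes, decided by
    membership of these two nodes.\<close>
  let ?U = "\<lambda>(s, t). {T :: nat list set. prefix s t \<longrightarrow> t \<in> T \<longrightarrow> s \<in> T}"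
  have "openin powerset_space (?U p)" for p
  proof (cases p)
    case (Pair s t)
    show ?thesis
      by (rule openin_powerset_spaceI, rule exI[of _ "{s, t}"]) (auto simp: Pair in_cell_iff)
  qed
  from Polish_space_countable_Inter[OF Polish_powerset_space, of UNIV ?U] this
  have "Polish_space (subtopology powerset_space (\<Inter>p. ?U p))" by simp
  moreover have "(\<Inter>p. ?U p) = Tree" by (auto simp: Tree_def)
  ultimately show ?thesis by (simp add: Tree_space_def)
qed

section \<open>Borel sets and measurability of tree-valued maps\<close>

lemma sets_borel_of: "sets (borel_of X) = sigma_sets (topspace X) {U. openin X U}"
  unfolding borel_of_def by (rule sets_measure_of) (auto dest: openin_subset)

lemma space_borel_of [simp]: "space (borel_of X) = topspace X"
  unfolding borel_of_def by (rule space_measure_of) (auto dest: openin_subset)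

lemma closedin_sets_borel_of:
  assumes "closedin X C" shows "C \<in> sets (borel_of X)"
proof -
  have "topspace X - C \<in> sets (borel_of X)"
    using assms by (auto simp: sets_borel_of closedin_def intro!: sigma_sets.Basic)
  then have "space (borel_of X) - (topspace X - C) \<in> sets (borel_of X)" by (rule sets.compl_sets)
  then show ?thesis using closedin_subset[OF assms] by (simp add: double_diff)
qed

text \<open>An open set of trees is a countable union of traces of cells, and the preimage of a cell
  is a finite Boolean combination of the sets in \<open>m\<close>.\<close>

lemma measurable_Tree_space:
  assumes f: "\<And>y. y \<in> space M \<Longrightarrow> f y \<in> Tree"
    and m: "\<And>s. {y \<in> space M. s \<in> f y} \<in> sets M"
  shows "f \<in> M \<rightarrow>\<^sub>M borel_of Tree_space"
  unfolding borel_of_def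
proof (rule measurable_measure_of)
  show "{U. openin Tree_space U} \<subseteq> Pow (topspace Tree_space)"
    using openin_subset[of Tree_space] by auto
  show "f \<in> space M \<rightarrow> topspace Tree_space" using f by simp
  fix U assume "U \<in> {U. openin Tree_space U}"
  then obtain V where V: "openin powerset_space V" "U = V \<inter> Tree"
    by (auto simp: Tree_space_def openin_subtopology)
  have 1: "f -` W \<inter> space M \<in> sets M" if W: "W \<in> cells" for W
  proof -
    obtain A S where A: "finite A" "W = cell A S" using W by (rule cellsE)
    have "{y \<in> space M. s \<in> f y \<longleftrightarrow> s \<in> S} \<in> sets M" for s
    proof (cases "s \<in> S")
      case True then show ?thesis using m[of s] by simp
    next
      case False
      have "space M - {y \<in> space M. s \<in> f y} \<in> sets M" using m by (rule sets.compl_sets)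
      moreover have "space M - {y \<in> space M. s \<in> f y} = {y \<in> space M. s \<notin> f y}" by auto
      ultimately show ?thesis using False by simp
    qed
    then have "{y \<in> space M. \<forall>s\<in>A. s \<in> f y \<longleftrightarrow> s \<in> S} \<in> sets M"
      using A(1) by (intro sets.sets_Collect_finite_All) auto
    moreover have "f -` W \<inter> space M = {y \<in> space M. \<forall>s\<in>A. s \<in> f y \<longleftrightarrow> s \<in> S}"
      by (auto simp: A(2) in_cell_iff)
    ultimately show ?thesis by simp
  qed
  have "f -` U \<inter> space M = (\<Union>W\<in>{W \<in> cells. W \<subseteq> V}. f -` W \<inter> space M)" (is "_ = ?R")
  proof
    show "f -` U \<inter> space M \<subseteq> ?R"
    proof
      fix y assume y: "y \<in> f -` U \<inter> space M"
      then have "f y \<in> V" using V(2) by simp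
      with V(1) obtain W where "W \<in> cells" "f y \<in> W" "W \<subseteq> V" by (rule cells_base)
      then show "y \<in> ?R" using y by blast
    qed
    show "?R \<subseteq> f -` U \<inter> space M" using V(2) f by auto
  qed
  also have "\<dots> \<in> sets M"
    using 1 by (intro sets.countable_UN') (auto intro: countable_subset[OF _ countable_cells])
  finally show "f -` U \<inter> space M \<in> sets M" .
qed

section \<open>Analytic conditions on trees\<close>

text \<open>The pairs \<open>(T, H)\<close> as described form a \<open>G\<^sub>\<delta>\<close> set,
  since an existential over nodes is an open condition; projecting to \<open>T\<close> is
  continuous.\<close>

lemma analytic_in_Tree_space:
  fixes Q :: "nat list \<Rightarrow> nat \<Rightarrow> nat list \<Rightarrow> bool"
  shows "analytic_in Tree_space {T \<in> Tree. \<exists>H\<subseteq>T. H \<noteq> {} \<and> (\<forall>t\<in>H. \<forall>m. \<exists>u\<in>H. Q t m u)}"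
    (is "analytic_in _ ?A")
proof -
  \<comment> \<open>A pair \<open>(T, H)\<close> is coded by the single set \<open>{0 # s |s. s \<in> T} \<union> {1 # s |s. s \<in> H}\<close>.\<close>
  define f where "f W = {s :: nat list. 0 # s \<in> W}" for W
  define h where "h W = {s :: nat list. 1 # s \<in> W}" for W
  \<comment> \<open>One condition per triple \<open>(s, t, m)\<close>: closure under initial
    segments for \<open>(s, t)\<close>, the inclusion for \<open>t\<close>, a witness for
    \<open>(t, m)\<close>; nonemptiness is repeated in each.\<close>
  define U where "U p = (case p of (s, t, m) \<Rightarrow>
    {W. (prefix s t \<longrightarrow> t \<in> f W \<longrightarrow> s \<in> f W) \<and> (t \<in> h W \<longrightarrow> t \<in> f W) \<and> h W \<noteq> {} \<and>
        (t \<in> h W \<longrightarrow> (\<exists>u. u \<in> h W \<and> Q t m u))})" for p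
  have op: "openin powerset_space (U p)" for p
  proof (rule openin_powerset_spaceI)
    fix W assume W: "W \<in> U p"
    obtain s t m where p: "p = (s, t, m)" by (cases p) auto
    have W': "(prefix s t \<longrightarrow> t \<in> f W \<longrightarrow> s \<in> f W) \<and> (t \<in> h W \<longrightarrow> t \<in> f W) \<and> h W \<noteq> {} \<and>
        (t \<in> h W \<longrightarrow> (\<exists>u. u \<in> h W \<and> Q t m u))"
      using W by (simp add: U_def p)
    \<comment> \<open>Adding the witnesses \<open>v\<close> and \<open>u\<close> to the finite set
      of decided nodes keeps both existential statements true throughout the cell.\<close>
    obtain v where v: "v \<in> h W" using W' by blast
    obtain u where u: "t \<in> h W \<longrightarrow> u \<in> h W \<and> Q t m u" using W' by blast
    let ?A = "{0 # s, 0 # t, 1 # t, 1 # u, 1 # v}"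
    have "cell ?A W \<subseteq> U p"
    proof
      fix V assume "V \<in> cell ?A W"
      then have "s \<in> f V \<longleftrightarrow> s \<in> f W" "t \<in> f V \<longleftrightarrow> t \<in> f W" "t \<in> h V \<longleftrightarrow> t \<in> h W"
        "u \<in> h V \<longleftrightarrow> u \<in> h W" "v \<in> h V \<longleftrightarrow> v \<in> h W"
        by (simp_all add: f_def h_def in_cell_iff)
      moreover from this v have "h V \<noteq> {}" by blast
      ultimately show "V \<in> U p" using W' u unfolding U_def p by (simp add: exI[of _ u])
    qed
    then show "\<exists>A. finite A \<and> cell A W \<subseteq> U p" by (intro exI[of _ ?A]) simp
  qed
  define P where "P = subtopology powerset_space (\<Inter>p. U p)"
  have P: "Polish_space P"
    using Polish_space_countable_Inter[OF Polish_powerset_space, of UNIV U] op by (simp add: P_def)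
  have W_iff: "W \<in> (\<Inter>p. U p) \<longleftrightarrow>
      f W \<in> Tree \<and> h W \<subseteq> f W \<and> h W \<noteq> {} \<and> (\<forall>t\<in>h W. \<forall>m. \<exists>u\<in>h W. Q t m u)" for W
  proof
    assume "W \<in> (\<Inter>p. U p)"
    then have U: "W \<in> U (s, t, m)" for s t m by blast
    have "s \<in> f W" if "t \<in> f W" "prefix s t" for s t
      using U[of s t 0] that by (simp add: U_def)
    then have "f W \<in> Tree" unfolding Tree_def by blast
    moreover have "t \<in> f W" if "t \<in> h W" for t using U[of "[]" t 0] that by (simp add: U_def)
    then have "h W \<subseteq> f W" by (rule subsetI)
    moreover have "h W \<noteq> {}" using U[of "[]" "[]" 0] by (simp add: U_def)
    moreover have "\<exists>u\<in>h W. Q t m u" if "t \<in> h W" for t m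
      using U[of "[]" t m] that by (simp add: U_def Bex_def)
    ultimately show "f W \<in> Tree \<and> h W \<subseteq> f W \<and> h W \<noteq> {} \<and> (\<forall>t\<in>h W. \<forall>m. \<exists>u\<in>h W. Q t m u)"
      by blast
  next
    assume *: "f W \<in> Tree \<and> h W \<subseteq> f W \<and> h W \<noteq> {} \<and> (\<forall>t\<in>h W. \<forall>m. \<exists>u\<in>h W. Q t m u)"
    have "W \<in> U (s, t, m)" for s t m
    proof -
      have "prefix s t \<longrightarrow> t \<in> f W \<longrightarrow> s \<in> f W" using * unfolding Tree_def by blast
      moreover have "t \<in> h W \<longrightarrow> (\<exists>u. u \<in> h W \<and> Q t m u)" using * by (simp add: Bex_def)
      moreover have "t \<in> h W \<longrightarrow> t \<in> f W" using * by blast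
      ultimately show ?thesis using * by (simp add: U_def)
    qed
    then have "W \<in> U p" for p by (cases p) simp
    then show "W \<in> (\<Inter>p. U p)" by (rule INT_I)
  qed
  have "continuous_map powerset_space powerset_space f"
    unfolding continuous_map_def
  proof (intro conjI allI impI)
    fix V assume V: "openin powerset_space V"
    have "openin powerset_space {W. f W \<in> V}"
    proof (rule openin_powerset_spaceI)
      fix W assume "W \<in> {W. f W \<in> V}"
      then have "f W \<in> V" by simp
      with V obtain A where A: "finite A" "cell A (f W) \<subseteq> V" by (rule openin_powerset_spaceE)
      have "cell ((#) 0 ` A) W \<subseteq> {W. f W \<in> V}"
      proof
        fix W' assume "W' \<in> cell ((#) 0 ` A) W"
        then have "f W' \<in> cell A (f W)" by (simp add: f_def in_cell_iff)
        then show "W' \<in> {W. f W \<in> V}" using A(2) by auto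
      qed
      then show "\<exists>A. finite A \<and> cell A W \<subseteq> {W. f W \<in> V}"
        using A(1) by (intro exI[of _ "(#) 0 ` A"]) simp
    qed
    then show "openin powerset_space {W \<in> topspace powerset_space. f W \<in> V}" by simp
  qed simp
  then have "continuous_map P Tree_space f"
    unfolding P_def Tree_space_def
  proof (intro continuous_map_into_subtopology continuous_map_from_subtopology)
    have "f W \<in> Tree" if "W \<in> (\<Inter>p. U p)" for W using that unfolding W_iff by simp
    then show "f \<in> topspace (subtopology powerset_space (\<Inter>p. U p)) \<rightarrow> Tree"
      unfolding topspace_subtopology topspace_powerset_space Int_UNIV_left by (rule Pi_I)
  qed
  from analytic_in_continuous_image[OF P this]
  have "analytic_in Tree_space (f ` (\<Inter>p. U p))" by (simp add: P_def)
  moreover have "f ` (\<Inter>p. U p) = ?A"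
  proof
    have "f W \<in> ?A" if "W \<in> (\<Inter>p. U p)" for W
      using that unfolding W_iff by (intro CollectI conjI exI[of _ "h W"]) simp_all
    then show "f ` (\<Inter>p. U p) \<subseteq> ?A" by (rule image_subsetI)
    show "?A \<subseteq> f ` (\<Inter>p. U p)"
    proof
      fix T assume "T \<in> ?A"
      then obtain H where H: "T \<in> Tree" "H \<subseteq> T" "H \<noteq> {}" "\<forall>t\<in>H. \<forall>m. \<exists>u\<in>H. Q t m u" by blast
      let ?W = "(#) 0 ` T \<union> (#) 1 ` H"
      have fh: "f ?W = T" "h ?W = H" by (auto simp: f_def h_def)
      have "?W \<in> (\<Inter>p. U p)" unfolding W_iff fh using H by simp
      with fh(1)[symmetric] show "T \<in> f ` (\<Inter>p. U p)" by (rule image_eqI)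
    qed
  qed
  ultimately show ?thesis by simp
qed

section \<open>Reducing an analytic set\<close>

lemma restr_Suc: "x \<restriction> Suc n = x \<restriction> n @ [x n]"
  by (simp add: restr_def)

lemma length_restr [simp]: "length (x \<restriction> n) = n"
  by (simp add: restr_def)

lemma nth_restr [simp]: "i < n \<Longrightarrow> (x \<restriction> n) ! i = x i"
  by (simp add: restr_def)

lemma take_restr: "m \<le> n \<Longrightarrow> take m (x \<restriction> n) = x \<restriction> m"
  by (simp add: restr_def take_map)

text \<open>\<open>F s\<close> is the closure of the image of a closed piece \<open>K s\<close> of a
  complete space \<open>P\<close> mapped onto \<open>B\<close>. Along a branch the pieces shrink to
  a point \<open>p\<close> by completeness, and continuity together with the Hausdorff property
  forces \<open>y = g p\<close>.\<close>

lemma analytic_in_Suslin_scheme: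
  assumes Y: "Polish_space Y" and B: "analytic_in Y B"
  obtains F :: "nat list \<Rightarrow> 'b set" where
    "\<forall>s. closedin Y (F s)" "\<forall>s t. prefix s t \<longrightarrow> F t \<subseteq> F s"
    "\<forall>y. y \<in> B \<longleftrightarrow> (\<exists>z. \<forall>n. y \<in> F (z \<restriction> n))"
proof -
  have Haus: "Hausdorff_space Y"
    using Y unfolding Polish_space_def
    by (meson completely_metrizable_imp_metrizable_space metrizable_imp_Hausdorff_space)
  obtain P :: "(nat \<Rightarrow> nat) topology" and g
    where P: "Polish_space P" and g: "continuous_map P Y g" and gB: "g ` topspace P = B"
    using B unfolding analytic_in_def by blast
  obtain M d where M: "Metric_space M d" "Metric_space.mcomplete M d" "P = Metric_space.mtopology M d"
    using P unfolding Polish_space_def completely_metrizable_space_def by blast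
  interpret Metric_space M d by fact
  have PM: "topspace P = M" using M(3) by simp
  obtain C where C: "countable C" "C \<subseteq> M" "P closure_of C = M"
  proof -
    have "separable_space P"
      using P by (simp add: Polish_space_def second_countable_imp_separable_space)
    then show thesis using that unfolding separable_space_def PM by (elim exE conjE)
  qed
  \<comment> \<open>\<open>c\<close> enumerates a dense set. When \<open>M\<close> is empty it takes
    a default value, and the intersection with \<open>M\<close> makes every \<open>K s\<close>
    empty.\<close>
  define c where "c = from_nat_into C"
  \<comment> \<open>Balls are intersected rather than chosen nested, so the scheme is monotone by
    construction and the entries of a branch can be picked independently.\<close>
  define K where "K s = M \<inter> (\<Inter>i<length s. mcball (c (s ! i)) ((1/2) ^ i))" for s :: "nat list"
  define F where "F s = Y closure_of (g ` K s)" for s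
  have Kcl: "closedin P (K s)" for s
  proof -
    have "closedin mtopology (\<Inter>(insert M ((\<lambda>i. mcball (c (s ! i)) ((1/2) ^ i)) ` {..<length s})))"
    proof (rule closedin_Inter)
      fix S assume "S \<in> insert M ((\<lambda>i. mcball (c (s ! i)) ((1/2) ^ i)) ` {..<length s})"
      then show "closedin mtopology S"
        using closedin_topspace[of mtopology] by (elim insertE imageE) simp_all
    qed simp
    then show ?thesis unfolding K_def M(3) by simp
  qed
  have Kmono: "K t \<subseteq> K s" if "prefix s t" for s t
  proof -
    from that obtain u where "t = s @ u" by (auto simp: prefix_def)
    then have t: "t ! i = s ! i" "i < length t" if "i < length s" for i
      using that by (simp_all add: nth_append)
    show ?thesis
    proof
      fix x assume x: "x \<in> K t"
      have "x \<in> mcball (c (s ! i)) ((1/2) ^ i)" if "i < length s" for i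
      proof -
        have "x \<in> mcball (c (t ! i)) ((1/2) ^ i)" using x t(2)[OF that] unfolding K_def by blast
        then show ?thesis by (simp only: t(1)[OF that])
      qed
      then show "x \<in> K s" using x unfolding K_def by blast
    qed
  qed
  have KM: "K s \<subseteq> M" for s by (simp add: K_def)
  have gY: "g x \<in> topspace Y" if "x \<in> M" for x
    using continuous_map_image_subset_topspace[OF g] that PM by blast
  show thesis
  proof
    show "\<forall>s. closedin Y (F s)" by (simp add: F_def)
    show "\<forall>s t. prefix s t \<longrightarrow> F t \<subseteq> F s"
      unfolding F_def by (intro allI impI closure_of_mono image_mono Kmono)
    show "\<forall>y. y \<in> B \<longleftrightarrow> (\<exists>z. \<forall>n. y \<in> F (z \<restriction> n))"
    proof (intro allI iffI)
      fix y
      assume "y \<in> B"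
      then obtain p where p: "p \<in> M" "y = g p" using gB PM by blast
      have "\<exists>k. p \<in> mcball (c k) ((1/2) ^ i)" for i
      proof -
        have "p \<in> P closure_of C" using C p by simp
        then have "\<forall>r>0. \<exists>q\<in>C. q \<in> mball p r" by (simp add: M(3) metric_closure_of)
        moreover have "(1/2 :: real) ^ i > 0" by simp
        ultimately obtain q where q: "q \<in> C" "q \<in> mball p ((1/2) ^ i)" by blast
        obtain k where k: "c k = q"
          unfolding c_def using from_nat_into_surj[OF C(1) q(1)] by (elim exE)
        have "p \<in> mcball (c k) ((1/2) ^ i)" using p(1) q(2) by (simp add: k commute)
        then show ?thesis by (rule exI)
      qed
      then obtain z where z: "\<And>i. p \<in> mcball (c (z i)) ((1/2) ^ i)" by metis
      then have pK: "p \<in> K (z \<restriction> n)" for n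
        using p(1) unfolding K_def by (intro IntI INT_I) simp_all
      have "y \<in> F (z \<restriction> n)" for n
      proof -
        have "g ` K (z \<restriction> n) \<subseteq> topspace Y"
          using gY KM by (meson image_subsetI subsetD)
        then have "g ` K (z \<restriction> n) \<subseteq> F (z \<restriction> n)" unfolding F_def by (rule closure_of_subset)
        then show ?thesis using pK[of n] p(2) by blast
      qed
      then show "\<exists>z. \<forall>n. y \<in> F (z \<restriction> n)" by blast
    next
      fix y
      assume "\<exists>z. \<forall>n. y \<in> F (z \<restriction> n)"
      then obtain z where z: "\<And>n. y \<in> F (z \<restriction> n)" by blast
      let ?K = "\<lambda>n. K (z \<restriction> n)"
      \<comment> \<open>The ball of radius \<open>(1/2) ^ n\<close> comes from the entry at position
        \<open>n\<close>, which first occurs at length \<open>Suc n\<close>.\<close>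
      have small: "?K (Suc n) \<subseteq> mcball (c (z n)) ((1/2) ^ n)" for n
      proof
        fix x assume x: "x \<in> ?K (Suc n)"
        have "n < length (z \<restriction> Suc n)" by simp
        then have "x \<in> mcball (c ((z \<restriction> Suc n) ! n)) ((1/2) ^ n)" using x unfolding K_def by blast
        then show "x \<in> mcball (c (z n)) ((1/2) ^ n)" by (simp only: nth_restr[OF lessI])
      qed
      have half: "\<exists>n. (1/2) ^ n < (\<epsilon> :: real)" if "\<epsilon> > 0" for \<epsilon>
        using that real_arch_pow_inv[of \<epsilon> "1/2"] by auto
      \<comment> \<open>Cantor's intersection theorem; the pieces are nonempty because
        \<open>y\<close> lies in the closures of their images.\<close>
      have "\<Inter> (range ?K) \<noteq> {}"
      proof (rule M(2)[unfolded mcomplete_nest, rule_format], intro conjI allI impI)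
        show "closedin mtopology (?K n)" for n using Kcl M(3) by simp
        show "?K n \<noteq> {}" for n using z[of n] by (rule contrapos_pn) (simp add: F_def)
        show "decseq ?K"
          by (rule decseq_SucI, rule Kmono) (simp add: restr_Suc)
        show "\<exists>n a. ?K n \<subseteq> mcball a \<epsilon>" if e: "\<epsilon> > 0" for \<epsilon>
        proof -
          obtain n where "(1/2) ^ n < \<epsilon>" using half[OF e] by blast
          then show ?thesis
            using small[of n] mcball_subset_concentric[of "(1/2) ^ n" \<epsilon>]
            by (meson less_imp_le order_trans)
        qed
      qed
      then obtain p where p: "\<And>n. p \<in> ?K n" by blast
      then have pM: "p \<in> M" using KM by blast
      have yY: "y \<in> topspace Y"
        using z[of 0] closure_of_subset_topspace[of Y] unfolding F_def by blast
      have "y = g p"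
      proof (rule ccontr)
        assume "y \<noteq> g p"
        then obtain U V where UV: "openin Y U" "openin Y V" "y \<in> U" "g p \<in> V" "disjnt U V"
          using Haus yY gY[OF pM] unfolding Hausdorff_space_def by blast
        have "openin P {x \<in> topspace P. g x \<in> V}" using g UV(2) by (rule openin_continuous_map_preimage)
        moreover have "p \<in> {x \<in> topspace P. g x \<in> V}" using UV(4) pM PM by simp
        ultimately obtain r where r: "r > 0" "mball p r \<subseteq> {x \<in> topspace P. g x \<in> V}"
          unfolding M(3) openin_mtopology by blast
        \<comment> \<open>Two points of a ball of radius \<open>(1/2) ^ n\<close> are at distance at
          most twice that, whence \<open>r / 2\<close>.\<close>
        obtain n where n: "(1/2) ^ n < r / 2" using half[of "r / 2"] r(1) by auto
        have "?K (Suc n) \<subseteq> mball p r"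
        proof
          fix x assume x: "x \<in> ?K (Suc n)"
          have "c (z n) \<in> M" "d (c (z n)) p \<le> (1/2) ^ n" "d (c (z n)) x \<le> (1/2) ^ n" "x \<in> M"
            using subsetD[OF small p[of "Suc n"]] subsetD[OF small x] by simp_all
          then show "x \<in> mball p r"
            using n pM triangle[of p "c (z n)" x] by (simp add: commute)
        qed
        then have "g ` ?K (Suc n) \<subseteq> V" using r(2) by blast
        then have "U \<inter> g ` ?K (Suc n) = {}" using UV(5) by (auto simp: disjnt_def)
        moreover have "y \<in> Y closure_of (g ` ?K (Suc n))" using z[of "Suc n"] by (simp add: F_def)
        ultimately show False using UV(1,3) unfolding in_closure_of by blast
      qed
      then show "y \<in> B" using pM gB PM by blast
    qed
  qed
qed

text \<open>A branch of \<open>f y\<close> codes a branch \<open>z\<close> through the Suslin scheme at \<open>y\<close> together with an arbitrary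
  sequence, so that the body is empty or contains a copy of \<open>{z} \<times> \<omega>\<^sup>\<omega>\<close>.\<close>

lemma analytic_in_reduction:
  assumes Y: "Polish_space Y" and B: "analytic_in Y B"
  obtains f where "f \<in> borel_of Y \<rightarrow>\<^sub>M borel_of Tree_space"
    "\<forall>y. y \<notin> B \<longrightarrow> body (f y) = {}"
    "\<forall>y\<in>B. \<exists>H\<subseteq>f y. H \<noteq> {} \<and> (\<forall>t\<in>H. \<forall>m. \<exists>k>m. t @ [k] \<in> H)"
proof -
  obtain F where "\<forall>s. closedin Y (F s)" "\<forall>s t. prefix s t \<longrightarrow> F t \<subseteq> F s"
    "\<forall>y. y \<in> B \<longleftrightarrow> (\<exists>z. \<forall>n. y \<in> F (z \<restriction> n))"
    using assms by (rule analytic_in_Suslin_scheme)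
  note F = this[rule_format]
  \<comment> \<open>Each entry codes a pair: the first component follows the Suslin scheme, the
    second is unconstrained.\<close>
  define \<pi> :: "nat \<Rightarrow> nat" where "\<pi> = fst \<circ> prod_decode"
  define f where "f y = {t. y \<in> F (map \<pi> t)}" for y
  have "s \<in> f y" if "t \<in> f y" "prefix s t" for s t y
    using subsetD[OF F(2)[OF map_mono_prefix[OF that(2), of \<pi>]]] that(1) by (simp add: f_def)
  then have tree: "f y \<in> Tree" for y
    unfolding Tree_def by blast
  show thesis
  proof
    show "f \<in> borel_of Y \<rightarrow>\<^sub>M borel_of Tree_space"
    proof (rule measurable_Tree_space[OF tree])
      fix s
      have "{y \<in> space (borel_of Y). s \<in> f y} = F (map \<pi> s)"
        using closedin_subset[OF F(1)[of "map \<pi> s"]] by (auto simp add: f_def)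
      then show "{y \<in> space (borel_of Y). s \<in> f y} \<in> sets (borel_of Y)"
        using F(1) by (simp add: closedin_sets_borel_of)
    qed
    show "\<forall>y. y \<notin> B \<longrightarrow> body (f y) = {}"
    proof (intro allI impI)
      fix y assume y: "y \<notin> B"
      have "y \<in> B" if "x \<in> body (f y)" for x
      proof -
        have "y \<in> F ((\<pi> \<circ> x) \<restriction> n)" for n using that by (simp add: body_def f_def restr_def)
        then show ?thesis unfolding F(3) by blast
      qed
      then show "body (f y) = {}" using y by blast
    qed
    show "\<forall>y\<in>B. \<exists>H\<subseteq>f y. H \<noteq> {} \<and> (\<forall>t\<in>H. \<forall>m. \<exists>k>m. t @ [k] \<in> H)"
    proof
      fix y assume "y \<in> B"
      then have "\<exists>z. \<forall>n. y \<in> F (z \<restriction> n)" by (simp only: F(3))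
      then obtain z where z: "\<forall>n. y \<in> F (z \<restriction> n)" ..
      \<comment> \<open>With first components following \<open>z\<close> and free second components,
        this is a Laver tree with empty stem.\<close>
      let ?H = "{t. map \<pi> t = z \<restriction> length t}"
      have "t \<in> f y" if "t \<in> ?H" for t using that spec[OF z, of "length t"] by (simp add: f_def)
      then have sub: "?H \<subseteq> f y" by (rule subsetI)
      have nil: "[] \<in> ?H" by (simp add: restr_def)
      have "\<exists>k>m. t @ [k] \<in> ?H" if "t \<in> ?H" for t m
      proof (intro exI conjI)
        \<comment> \<open>A pair code is at least its second component, so \<open>Suc m\<close>
          there yields a code above \<open>m\<close>.\<close>
        let ?k = "prod_encode (z (length t), Suc m)"
        show "m < ?k" using le_prod_encode_2[of "Suc m" "z (length t)"] by simp
        show "t @ [?k] \<in> ?H" using that by (simp add: restr_Suc \<pi>_def)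
      qed
      then have "\<forall>t\<in>?H. \<forall>m. \<exists>k>m. t @ [k] \<in> ?H" by (intro ballI allI)
      moreover have "?H \<noteq> {}" using nil by (metis empty_iff)
      ultimately show "\<exists>H\<subseteq>f y. H \<noteq> {} \<and> (\<forall>t\<in>H. \<forall>m. \<exists>k>m. t @ [k] \<in> H)" using sub by (intro exI[of _ ?H] conjI)
    qed
  qed
qed

section \<open>Closed sets that are not \<open>\<sigma>\<close>-compact\<close>

lemma prefix_nth:
  assumes "prefix s t" "i < length s" shows "t ! i = s ! i"
  using assms by (elim prefixE) (simp add: nth_append)

lemma branch_of_chain:
  fixes t :: "nat \<Rightarrow> nat list"
  assumes "\<forall>n. strict_prefix (t n) (t (Suc n))"
  obtains x where "\<forall>n. x \<restriction> length (t n) = t n"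
proof
  \<comment> \<open>Strict growth gives \<open>t (Suc i)\<close> length at least
    \<open>Suc i\<close>, so this entry exists; comparability makes it agree with every
    \<open>t n\<close> that reaches position \<open>i\<close>.\<close>
  define x where "x i = t (Suc i) ! i" for i
  have mono: "prefix (t m) (t n)" if "m \<le> n" for m n
    using that
  proof (induction n rule: dec_induct)
    case (step n)
    have "prefix (t n) (t (Suc n))" using assms by (simp add: strict_prefix_def)
    with step.IH show ?case by (rule prefix_order.trans)
  qed simp
  have len: "n \<le> length (t n)" for n
  proof (induction n)
    case (Suc n)
    have "length (t n) < length (t (Suc n))" using assms by (simp add: prefix_length_less)
    with Suc.IH show ?case by simp
  qed simp
  show "\<forall>n. x \<restriction> length (t n) = t n"
  proof
    fix n
    have "x i = t n ! i" if i: "i < length (t n)" for i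
    proof -
      have "i < length (t (Suc i))" using len[of "Suc i"] by simp
      then show ?thesis
        using prefix_nth[OF mono, of n "Suc i" i] prefix_nth[OF mono, of "Suc i" n i] i
        unfolding x_def by (cases "n \<le> Suc i") simp_all
    qed
    then show "x \<restriction> length (t n) = t n" by (intro nth_equalityI) simp_all
  qed
qed

lemma body_Tree_cofinal:
  assumes "T \<in> Tree" and "\<And>n. \<exists>m\<ge>n. x \<restriction> m \<in> T"
  shows "x \<in> body T"
  unfolding body_def
proof (intro CollectI allI)
  fix n
  obtain m where m: "m \<ge> n" "x \<restriction> m \<in> T" using assms(2) by blast
  have "prefix (x \<restriction> n) (x \<restriction> m)" using take_is_prefix[of n "x \<restriction> m"] m(1) by (simp add: take_restr)
  then show "x \<restriction> n \<in> T" using m(2) assms(1) unfolding Tree_def by blast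
qed

lemma prefix_snoc_strict: "prefix (s @ [k]) t \<Longrightarrow> strict_prefix s t"
  by (elim prefixE) (simp add: strict_prefix_def)

lemma compact_coordinate_bounded:
  fixes K :: "(nat \<Rightarrow> nat) set"
  assumes "compact K" shows "\<exists>b. \<forall>x\<in>K. x i \<le> b"
proof (cases "K = {}")
  case False
  have "compact ((\<lambda>x. x i) ` K)"
    using assms by (intro compact_continuous_image continuous_on_subset[OF continuous_on_product_coordinates]) simp_all
  then have "\<exists>b\<in>(\<lambda>x. x i) ` K. \<forall>y\<in>(\<lambda>x. x i) ` K. y \<le> b"
    using False by (intro compact_attains_sup) simp_all
  then show ?thesis by auto
qed simp

text \<open>Diagonalisation: if compact sets \<open>K n\<close> covered the body, the coordinates on
  \<open>K n\<close> would be bounded by \<open>g n\<close>. A chain in \<open>H\<close> that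
  exceeds \<open>g n\<close> right after its \<open>n\<close>-th node yields a branch outside every
  \<open>K n\<close>.\<close>

lemma superperfect_not_sigma_compact:
  assumes T: "T \<in> Tree" and H: "H \<subseteq> T" "H \<noteq> {}"
    and split: "\<forall>t\<in>H. \<forall>m. \<exists>u\<in>H. \<exists>k>m. prefix (t @ [k]) u"
  shows "\<not> sigma_compact (body T)"
proof
  assume "sigma_compact (body T)"
  then obtain K :: "nat \<Rightarrow> _" where K': "(\<forall>n. compact (K n)) \<and> body T = (\<Union>n. K n)"
    unfolding sigma_compact_def ..
  from K' have K: "body T = (\<Union>n. K n)" ..
  from K' have cpt: "compact (K n)" for n by blast
  define g where "g n i = (SOME b. \<forall>x\<in>K n. x i \<le> b)" for n i
  have g: "x i \<le> g n i" if "x \<in> K n" for x n i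
    using someI_ex[OF compact_coordinate_bounded[OF cpt[of n]], of i] that unfolding g_def by blast
  have "\<exists>t. \<forall>n. t n \<in> H \<and> (\<exists>k>g n (length (t n)). prefix (t n @ [k]) (t (Suc n)))"
  proof (rule dependent_nat_choice[where P = "\<lambda>_ t. t \<in> H"])
    show "\<exists>t. t \<in> H" using H(2) by blast
    show "\<exists>u. u \<in> H \<and> (\<exists>k>g n (length t). prefix (t @ [k]) u)" if "t \<in> H" for t n
      using split[rule_format, OF that, of "g n (length t)"] by (simp only: Bex_def)
  qed
  then obtain t where "\<forall>n. t n \<in> H \<and> (\<exists>k>g n (length (t n)). prefix (t n @ [k]) (t (Suc n)))" ..
  then have t: "t n \<in> H" "\<exists>k>g n (length (t n)). prefix (t n @ [k]) (t (Suc n))" for n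
    by simp_all
  have strict: "\<forall>n. strict_prefix (t n) (t (Suc n))"
  proof
    fix n
    from t(2)[of n] show "strict_prefix (t n) (t (Suc n))" by (elim exE conjE) (rule prefix_snoc_strict)
  qed
  then obtain x where x: "\<forall>n. x \<restriction> length (t n) = t n" by (rule branch_of_chain)
  have len: "n \<le> length (t n)" for n
  proof (induction n)
    case (Suc n)
    have "length (t n) < length (t (Suc n))" using strict by (simp add: prefix_length_less)
    with Suc.IH show ?case by simp
  qed simp
  have "x \<in> body T"
  proof (rule body_Tree_cofinal[OF T])
    fix n
    have "x \<restriction> length (t n) \<in> T" using x t(1)[of n] H(1) by auto
    then show "\<exists>m\<ge>n. x \<restriction> m \<in> T" using len[of n] by (intro exI[of _ "length (t n)"] conjI)
  qed
  then obtain n where n: "x \<in> K n" using K by blast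
  obtain k where k: "k > g n (length (t n))" "prefix (t n @ [k]) (t (Suc n))" using t(2)[of n] by blast
  have "length (t n) < length (t (Suc n))" using strict by (simp add: prefix_length_less)
  then have "x (length (t n)) = t (Suc n) ! length (t n)"
    using nth_restr[of "length (t n)" "length (t (Suc n))" x] x by simp
  also have "\<dots> = k" using prefix_nth[OF k(2), of "length (t n)"] by simp
  finally show False using g[OF n, of "length (t n)"] k(1) by simp
qed

section \<open>Closure properties of \<sigma>-compact sets\<close>

lemma sigma_compact_Union:
  assumes "countable \<K>" "\<And>K. K \<in> \<K> \<Longrightarrow> compact K"
  shows "sigma_compact (\<Union>\<K>)"
proof (cases "\<K> = {}")
  case True
  then show ?thesis unfolding sigma_compact_def by (intro exI[of _ "\<lambda>_. {}"]) simp
next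
  case False
  have "compact (from_nat_into \<K> n)" for n using assms(2) from_nat_into[OF False] by blast
  moreover have "\<Union>\<K> = (\<Union>n. from_nat_into \<K> n)" using range_from_nat_into[OF False assms(1)] by simp
  ultimately show ?thesis unfolding sigma_compact_def by blast
qed

lemma compact_imp_sigma_compact: "compact K \<Longrightarrow> sigma_compact K"
  using sigma_compact_Union[of "{K}"] by simp

lemma sigma_compact_empty: "sigma_compact {}"
  by (simp add: compact_imp_sigma_compact)

lemma sigma_compact_UN:
  assumes "countable I" "\<And>i. i \<in> I \<Longrightarrow> sigma_compact (A i)"
  shows "sigma_compact (\<Union>i\<in>I. A i)"
proof -
  have "\<forall>i\<in>I. \<exists>K :: nat \<Rightarrow> _. (\<forall>n. compact (K n)) \<and> A i = (\<Union>n. K n)"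
    using assms(2) unfolding sigma_compact_def by (rule ballI)
  then obtain K :: "_ \<Rightarrow> nat \<Rightarrow> _" where K: "\<forall>i\<in>I. (\<forall>n. compact (K i n)) \<and> A i = (\<Union>n. K i n)"
    by (rule exE[OF bchoice])
  have "sigma_compact (\<Union>((\<lambda>(i, n). K i n) ` (I \<times> UNIV)))"
    using assms(1) K by (intro sigma_compact_Union) auto
  moreover have "\<Union>((\<lambda>(i, n). K i n) ` (I \<times> UNIV)) = (\<Union>i\<in>I. A i)"
    using K by auto
  ultimately show ?thesis by simp
qed

section \<open>Clopen conditions and compactness in the Baire space\<close>

lemma open_restr: "open {x. x \<restriction> n \<in> A}"
proof -
  have "open {x. x \<restriction> n = s}" for s
  proof (cases "length s = n")
    case True
    have "x \<restriction> n = s \<longleftrightarrow> (\<forall>i<n. x i = s ! i)" for x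
      using True by (simp add: list_eq_iff_nth_eq)
    then have "{x. x \<restriction> n = s} = (\<Inter>i\<in>{..<n}. (\<lambda>x. x i) -` {s ! i})" by auto
    moreover have "open ((\<lambda>x :: nat \<Rightarrow> nat. x i) -` {s ! i})" for i
      by (intro open_vimage open_discrete continuous_on_product_coordinates)
    ultimately show ?thesis by (simp add: open_INT)
  next
    case False
    then have "{x. x \<restriction> n = s} = {}" by auto
    then show ?thesis by simp
  qed
  then have "open (\<Union>s\<in>A. {x. x \<restriction> n = s})" by (intro open_UN ballI)
  moreover have "(\<Union>s\<in>A. {x. x \<restriction> n = s}) = {x. x \<restriction> n \<in> A}" by auto
  ultimately show ?thesis by simp
qed

lemma closed_restr: "closed {x. x \<restriction> n \<in> A}"
  using open_restr[of n "- A"] unfolding closed_def by (simp add: Compl_eq)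

text \<open>By Tychonoff the product of the finite coordinate projections is compact, and
  \<open>K\<close> is a closed subset of it.\<close>

lemma compact_if_finite_coordinates:
  fixes K :: "(nat \<Rightarrow> nat) set"
  assumes "closed K" "\<And>n. finite ((\<lambda>x. x n) ` K)"
  shows "compact K"
proof -
  let ?P = "Pi\<^sub>E UNIV (\<lambda>n. (\<lambda>x. x n) ` K)"
  have "compactin (product_topology (\<lambda>_ :: nat. euclidean :: nat topology) UNIV) ?P"
    unfolding compactin_PiE using assms(2) by (simp add: finite_imp_compact)
  then have "compact ?P" by (simp add: euclidean_product_topology)
  moreover have "?P \<inter> K = K" by auto
  ultimately show ?thesis using assms(1) by (metis compact_Int_closed)
qed

text \<open>This is empty, hence \<sigma>-compact, when \<open>s\<close> lies outside
  \<open>T\<close>, so every node whose branch set is not \<sigma>-compact belongs to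
  \<open>T\<close>.\<close>

definition branches_through :: "nat list set \<Rightarrow> nat list \<Rightarrow> (nat \<Rightarrow> nat) set" where
  "branches_through T s = {x \<in> body T. x \<restriction> length s = s}"

text \<open>The branches \<open>x\<close> through \<open>s\<close> such that no \<open>branches_through T (x \<restriction> n)\<close> with \<open>n \<ge> length s\<close> is
  \<open>\<sigma>\<close>-compact form a compact set by Koenig's lemma; the rest is a countable union of \<open>\<sigma>\<close>-compact
  sets.\<close>

lemma sigma_compact_branches_through:
  assumes fin: "\<And>u. prefix s u \<Longrightarrow> finite {k. \<not> sigma_compact (branches_through T (u @ [k]))}"
  shows "sigma_compact (branches_through T s)"
proof -
  let ?S = "{t. \<not> sigma_compact (branches_through T t)}"
  define K where "K = {x \<in> branches_through T s. \<forall>n\<ge>length s. x \<restriction> n \<in> ?S}"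
  have "K = {x. x \<restriction> length s \<in> {s}} \<inter> (\<Inter>n. {x. x \<restriction> n \<in> T}) \<inter> (\<Inter>n\<in>{length s..}. {x. x \<restriction> n \<in> ?S})"
    unfolding K_def branches_through_def body_def by auto
  then have closed: "closed K" by (simp only:) (intro closed_Int closed_INT ballI closed_restr)
  have pre: "prefix s (x \<restriction> n)" if "x \<in> K" "n \<ge> length s" for x n
  proof -
    have "x \<restriction> length s = s" using that by (simp add: K_def branches_through_def)
    then show ?thesis using take_is_prefix[of "length s" "x \<restriction> n"] that(2) by (simp add: take_restr)
  qed
  \<comment> \<open>The induction starts at level \<open>length s\<close> because \<open>fin\<close>
    speaks of extensions of \<open>s\<close>; each of the finitely many nodes of a level then has
    finitely many successors in \<open>?S\<close>.\<close>
  have finR: "finite ((\<lambda>x. x \<restriction> n) ` K)" if "n \<ge> length s" for n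
    using that
  proof (induction n rule: dec_induct)
    case base
    have "(\<lambda>x. x \<restriction> length s) ` K \<subseteq> {s}" unfolding K_def branches_through_def by auto
    then show ?case by (rule finite_subset) simp
  next
    case (step n)
    let ?R = "\<Union>u\<in>(\<lambda>x. x \<restriction> n) ` K. (\<lambda>k. u @ [k]) ` {k. u @ [k] \<in> ?S}"
    have "(\<lambda>x. x \<restriction> Suc n) ` K \<subseteq> ?R"
    proof (rule image_subsetI)
      fix x assume x: "x \<in> K"
      then have "x \<restriction> Suc n \<in> ?S" using step.hyps unfolding K_def by simp
      then have "x \<restriction> Suc n \<in> (\<lambda>k. x \<restriction> n @ [k]) ` {k. x \<restriction> n @ [k] \<in> ?S}"
        unfolding restr_Suc by (intro imageI) simp
      then show "x \<restriction> Suc n \<in> ?R" using x by blast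
    qed
    moreover have "finite ?R"
    proof (intro finite_UN_I step.IH finite_imageI)
      fix u assume "u \<in> (\<lambda>x. x \<restriction> n) ` K"
      then have "prefix s u" using pre step.hyps by auto
      then show "finite {k. u @ [k] \<in> ?S}" using fin by simp
    qed
    ultimately show ?case by (rule finite_subset)
  qed
  have "finite ((\<lambda>x. x i) ` K)" for i
  proof -
    \<comment> \<open>A level past both the stem and position \<open>i\<close>, so that coordinate
      \<open>i\<close> can be read off from finitely many restrictions.\<close>
    let ?m = "max (length s) (Suc i)"
    have "(\<lambda>x. x i) ` K = (\<lambda>u. u ! i) ` (\<lambda>x. x \<restriction> ?m) ` K"
      unfolding image_image by (intro image_cong) simp_all
    then show ?thesis using finR[of ?m] by simp
  qed
  with closed have "compact K" by (rule compact_if_finite_coordinates)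
  \<comment> \<open>A branch through \<open>s\<close> outside \<open>K\<close> has an initial
    segment in \<open>?I\<close>, and there are only countably many finite sequences.\<close>
  let ?I = "{t. prefix s t \<and> sigma_compact (branches_through T t)}"
  have "sigma_compact (\<Union>A\<in>insert K (branches_through T ` ?I). A)"
  proof (rule sigma_compact_UN)
    show "countable (insert K (branches_through T ` ?I))" by simp
    show "sigma_compact A" if "A \<in> insert K (branches_through T ` ?I)" for A
      using that compact_imp_sigma_compact[OF \<open>compact K\<close>] by auto
  qed
  moreover have "(\<Union>A\<in>insert K (branches_through T ` ?I). A) = branches_through T s"
  proof
    have "K \<subseteq> branches_through T s" by (simp add: K_def)
    moreover have "branches_through T t \<subseteq> branches_through T s" if "prefix s t" for t
    proof
      fix x assume x: "x \<in> branches_through T t"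
      then have "x \<restriction> length s = take (length s) t"
        using take_restr[of "length s" "length t" x] prefix_length_le[OF that] by (simp add: branches_through_def)
      then show "x \<in> branches_through T s" using x that by (auto simp: branches_through_def prefix_def)
    qed
    ultimately show "(\<Union>A\<in>insert K (branches_through T ` ?I). A) \<subseteq> branches_through T s" by auto
    show "branches_through T s \<subseteq> (\<Union>A\<in>insert K (branches_through T ` ?I). A)"
    proof
      fix x assume x: "x \<in> branches_through T s"
      show "x \<in> (\<Union>A\<in>insert K (branches_through T ` ?I). A)"
      proof (cases "x \<in> K")
        case False
        then obtain n where n: "n \<ge> length s" "sigma_compact (branches_through T (x \<restriction> n))"
          using x unfolding K_def by blast
        have "x \<restriction> length s = s" using x by (simp add: branches_through_def)
        then have "prefix s (x \<restriction> n)"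
          using take_is_prefix[of "length s" "x \<restriction> n"] n(1) by (simp add: take_restr)
        moreover have "x \<in> branches_through T (x \<restriction> n)" using x by (simp add: branches_through_def)
        ultimately show ?thesis using n(2) by blast
      qed simp
    qed
  qed
  ultimately show ?thesis by simp
qed

text \<open>A dichotomy of Hurewicz type. Forwards, \<open>H\<close> collects the nodes with
  infinitely many non-\<sigma>-compact successors; \<open>sigma_compact_branches_through\<close>
  supplies one extending any node whose branch set is not \<sigma>-compact.\<close>

lemma not_sigma_compact_iff:
  assumes T: "T \<in> Tree"
  shows "\<not> sigma_compact (body T) \<longleftrightarrow>
    (\<exists>H\<subseteq>T. H \<noteq> {} \<and> (\<forall>t\<in>H. \<forall>m. \<exists>u\<in>H. \<exists>k>m. prefix (t @ [k]) u))"
proof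
  assume nsc: "\<not> sigma_compact (body T)"
  define H where "H = {u. infinite {k. \<not> sigma_compact (branches_through T (u @ [k]))}}"
  have ext: "\<exists>u\<in>H. prefix s u" if "\<not> sigma_compact (branches_through T s)" for s
  proof (rule ccontr)
    assume "\<not> (\<exists>u\<in>H. prefix s u)"
    then have "finite {k. \<not> sigma_compact (branches_through T (u @ [k]))}" if "prefix s u" for u
      using that unfolding H_def by blast
    then have "sigma_compact (branches_through T s)" by (rule sigma_compact_branches_through)
    with that show False by contradiction
  qed
  have "u \<in> T" if "u \<in> H" for u
  proof -
    from that have "{k. \<not> sigma_compact (branches_through T (u @ [k]))} \<noteq> {}"
      unfolding H_def by (metis finite.emptyI mem_Collect_eq)
    then obtain k where "\<not> sigma_compact (branches_through T (u @ [k]))" by blast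
    then have "branches_through T (u @ [k]) \<noteq> {}" using sigma_compact_empty by metis
    then obtain x where x: "x \<in> body T" "x \<restriction> length (u @ [k]) = u @ [k]"
      unfolding branches_through_def by blast
    then have "x \<restriction> length u = u" by (simp add: restr_Suc)
    moreover have "x \<restriction> length u \<in> T" using x(1) by (simp add: body_def)
    ultimately show ?thesis by simp
  qed
  then have "H \<subseteq> T" by (rule subsetI)
  moreover have "branches_through T [] = body T" by (simp add: branches_through_def restr_def)
  then have "H \<noteq> {}" using ext[of "[]"] nsc by auto
  moreover have "\<exists>u\<in>H. \<exists>k>m. prefix (t @ [k]) u" if "t \<in> H" for t m
  proof -
    from that obtain k where "k > m" "\<not> sigma_compact (branches_through T (t @ [k]))"
      unfolding H_def infinite_nat_iff_unbounded by blast
    with ext[of "t @ [k]"] show ?thesis by blast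
  qed
  ultimately show "\<exists>H\<subseteq>T. H \<noteq> {} \<and> (\<forall>t\<in>H. \<forall>m. \<exists>u\<in>H. \<exists>k>m. prefix (t @ [k]) u)"
    by (intro exI[of _ H] conjI ballI allI)
next
  assume "\<exists>H\<subseteq>T. H \<noteq> {} \<and> (\<forall>t\<in>H. \<forall>m. \<exists>u\<in>H. \<exists>k>m. prefix (t @ [k]) u)"
  then show "\<not> sigma_compact (body T)"
    by (elim exE conjE) (rule superperfect_not_sigma_compact[OF T])
qed

section \<open>Strongly dominating closed sets\<close>

text \<open>A derivative in inductive form: nodes with only finitely many surviving successors in
  \<open>T\<close> are discarded repeatedly. The survivors in \<open>T\<close> are the candidate
  Laver tree.\<close>

inductive blocked :: "nat list set \<Rightarrow> nat list \<Rightarrow> bool" for T where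
  blockedI: "(\<And>k. k > m \<Longrightarrow> t @ [k] \<in> T \<Longrightarrow> blocked T (t @ [k])) \<Longrightarrow> blocked T t"

text \<open>At \<open>t\<close> the function demands more than \<open>m\<close>, so a branch obeying
  it enters a blocked successor, where the function from the induction hypothesis takes over. The
  bound \<open>n \<ge> length t\<close> later places failures arbitrarily far out.\<close>

lemma blocked_function:
  assumes "blocked T t"
  shows "\<exists>f. \<forall>x\<in>body T. x \<restriction> length t = t \<longrightarrow> (\<exists>n\<ge>length t. x n < f (x \<restriction> n))"
  using assms
proof induction
  case (blockedI m t)
  have "\<forall>k. \<exists>f. k > m \<and> t @ [k] \<in> T \<longrightarrow> (\<forall>x\<in>body T. x \<restriction> length (t @ [k]) = t @ [k]
      \<longrightarrow> (\<exists>n\<ge>length (t @ [k]). x n < f (x \<restriction> n)))" (is "\<forall>k. \<exists>f. ?A k \<longrightarrow> ?B k f")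
  proof
    fix k
    show "\<exists>f. ?A k \<longrightarrow> ?B k f"
    proof (cases "?A k")
      case True
      then have "\<exists>f. ?B k f" by (elim conjE) (rule blockedI.IH)
      then show ?thesis by (elim exE) (intro exI impI)
    next
      case False
      then show ?thesis by (intro exI impI) (rule notE)
    qed
  qed
  then obtain f where f: "\<forall>k. k > m \<and> t @ [k] \<in> T \<longrightarrow> (\<forall>x\<in>body T. x \<restriction> length (t @ [k]) = t @ [k]
      \<longrightarrow> (\<exists>n\<ge>length (t @ [k]). x n < f k (x \<restriction> n)))"
    by (rule exE[OF choice])
  \<comment> \<open>The entry after \<open>t\<close> selects the function of that successor. It is
    unspecified for short \<open>u\<close>, but the second case is evaluated only at restrictions
    longer than \<open>t\<close>.\<close>
  define g where "g u = (if u = t then Suc m else f (u ! length t) u)" for u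
  have "\<exists>n\<ge>length t. x n < g (x \<restriction> n)" if x: "x \<in> body T" "x \<restriction> length t = t" for x
  proof (cases "x (length t) \<le> m")
    case True
    then have "x (length t) < g (x \<restriction> length t)" using x(2) by (simp add: g_def)
    then show ?thesis by (intro exI[of _ "length t"]) simp
  next
    case False
    let ?k = "x (length t)"
    have xk: "x \<restriction> length (t @ [?k]) = t @ [?k]" using x(2) by (simp add: restr_Suc)
    have "x \<restriction> length (t @ [?k]) \<in> T" using x(1) unfolding body_def by blast
    then have "t @ [?k] \<in> T" by (simp only: xk)
    then have "\<forall>y\<in>body T. y \<restriction> length (t @ [?k]) = t @ [?k] \<longrightarrow>
        (\<exists>n\<ge>length (t @ [?k]). y n < f ?k (y \<restriction> n))"
      using spec[OF f, of ?k] False by simp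
    then have "\<exists>n\<ge>length (t @ [?k]). x n < f ?k (x \<restriction> n)"
      using x(1) xk by simp
    then obtain n where n: "n \<ge> length (t @ [?k])" "x n < f ?k (x \<restriction> n)"
      by (elim exE conjE)
    have "length (x \<restriction> n) \<noteq> length t" using n(1) by simp
    then have "x \<restriction> n \<noteq> t" by blast
    moreover have "(x \<restriction> n) ! length t = ?k" using n(1) by simp
    ultimately show ?thesis using n unfolding g_def by (intro exI[of _ n]) simp
  qed
  then show ?case by (intro exI[of _ g]) simp
qed

text \<open>From any node of \<open>H\<close>, each next entry is chosen above the value of
  \<open>f\<close> at the current node; the resulting branch meets \<open>f\<close> from the first
  node on.\<close>

lemma Laver_strongly_dominating:
  assumes T: "T \<in> Tree" and H: "H \<subseteq> T" "H \<noteq> {}"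
    and split: "\<forall>t\<in>H. \<forall>m. \<exists>u\<in>H. \<exists>k>m. u = t @ [k]"
  shows "strongly_dominating (body T)"
  unfolding strongly_dominating_def
proof
  fix f :: "nat list \<Rightarrow> nat"
  have "\<exists>t. \<forall>n. t n \<in> H \<and> (\<exists>k>f (t n). t (Suc n) = t n @ [k])"
  proof (rule dependent_nat_choice[where P = "\<lambda>_ t. t \<in> H"])
    show "\<exists>t. t \<in> H" using H(2) by blast
    show "\<exists>u. u \<in> H \<and> (\<exists>k>f t. u = t @ [k])" if "t \<in> H" for t and n :: nat
      using split[rule_format, OF that, of "f t"] by (simp only: Bex_def)
  qed
  then obtain t where "\<forall>n. t n \<in> H \<and> (\<exists>k>f (t n). t (Suc n) = t n @ [k])" ..
  then have t: "t n \<in> H" "\<exists>k>f (t n). t (Suc n) = t n @ [k]" for n by simp_all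
  have "\<forall>n. strict_prefix (t n) (t (Suc n))"
  proof
    fix n
    obtain k where "t (Suc n) = t n @ [k]" using t(2)[of n] by blast
    then show "strict_prefix (t n) (t (Suc n))" by (simp add: strict_prefix_def)
  qed
  then obtain x where x: "\<forall>n. x \<restriction> length (t n) = t n" by (rule branch_of_chain)
  \<comment> \<open>Levels below \<open>l\<close> form the uncontrolled stem, which an eventual
    condition tolerates; \<open>t n\<close> sits at level \<open>l + n\<close>.\<close>
  define l where "l = length (t 0)"
  have len: "length (t n) = l + n" for n
  proof (induction n)
    case (Suc n)
    obtain k where "t (Suc n) = t n @ [k]" using t(2)[of n] by blast
    then show ?case using Suc.IH by simp
  qed (simp add: l_def)
  have "x \<in> body T"
  proof (rule body_Tree_cofinal[OF T])
    fix n
    have "x \<restriction> (l + n) \<in> T" using spec[OF x, of n] t(1)[of n] H(1) by (auto simp: len)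
    then show "\<exists>m\<ge>n. x \<restriction> m \<in> T" by (intro exI[of _ "l + n"]) simp
  qed
  moreover have "f (x \<restriction> n) \<le> x n" if n: "n \<ge> l" for n
  proof -
    define i where "i = n - l"
    have i: "length (t i) = n" using n by (simp add: i_def len)
    obtain k where k: "k > f (t i)" "t (Suc i) = t i @ [k]" using t(2)[of i] by blast
    have xi: "x \<restriction> n = t i" using spec[OF x, of i] by (simp only: i)
    have "x \<restriction> Suc n = t i @ [k]" using spec[OF x, of "Suc i"] by (simp only: k(2) length_append_singleton i)
    then have "x n = k" by (simp add: restr_Suc)
    then show ?thesis using xi k(1) by simp
  qed
  then have "\<forall>\<^sub>F n in sequentially. f (x \<restriction> n) \<le> x n" by (rule eventually_sequentiallyI)
  ultimately show "\<exists>x\<in>body T. \<forall>\<^sub>F n in sequentially. f (x \<restriction> n) \<le> x n" by (intro bexI[of _ x])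
qed

text \<open>An unblocked node has infinitely many unblocked successors in \<open>T\<close>, so these
  nodes split as required. If there were none, a sum of functions from
  \<open>blocked_function\<close> would defeat every branch infinitely often.\<close>

lemma strongly_dominating_iff:
  assumes T: "T \<in> Tree"
  shows "strongly_dominating (body T) \<longleftrightarrow>
    (\<exists>H\<subseteq>T. H \<noteq> {} \<and> (\<forall>t\<in>H. \<forall>m. \<exists>u\<in>H. \<exists>k>m. u = t @ [k]))"
proof
  assume sd: "strongly_dominating (body T)"
  define H where "H = {t \<in> T. \<not> blocked T t}"
  have "H \<noteq> {}"
  proof
    assume H: "H = {}"
    have "\<forall>t. \<exists>f. t \<in> T \<longrightarrow>
        (\<forall>x\<in>body T. x \<restriction> length t = t \<longrightarrow> (\<exists>n\<ge>length t. x n < f (x \<restriction> n)))"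
    proof
      fix t
      have "t \<in> T \<Longrightarrow> blocked T t" using H unfolding H_def by blast
      then show "\<exists>f. t \<in> T \<longrightarrow>
        (\<forall>x\<in>body T. x \<restriction> length t = t \<longrightarrow> (\<exists>n\<ge>length t. x n < f (x \<restriction> n)))"
        using blocked_function[of T t] by (cases "t \<in> T") simp_all
    qed
    then obtain f where f: "\<forall>t. t \<in> T \<longrightarrow>
        (\<forall>x\<in>body T. x \<restriction> length t = t \<longrightarrow> (\<exists>n\<ge>length t. x n < f t (x \<restriction> n)))"
      by (rule exE[OF choice])
    \<comment> \<open>Summing over the initial segments of \<open>u\<close> dominates all \<open>f t\<close> with \<open>t\<close> a prefix of \<open>u\<close>.\<close>
    define g where "g u = (\<Sum>i\<le>length u. f (take i u) u)" for u
    obtain x where x: "x \<in> body T" "\<forall>\<^sub>F n in sequentially. g (x \<restriction> n) \<le> x n"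
      using sd[unfolded strongly_dominating_def, rule_format, of g] by (elim bexE)
    obtain N where N: "\<And>n. n \<ge> N \<Longrightarrow> g (x \<restriction> n) \<le> x n"
      using x(2) unfolding eventually_sequentially by blast
    \<comment> \<open>From \<open>N\<close> on, \<open>x\<close> meets \<open>g\<close>, yet
      blockedness of \<open>x \<restriction> N\<close> produces a failure at some
      \<open>n \<ge> N\<close>.\<close>
    have "x \<restriction> N \<in> T" using x(1) by (simp add: body_def)
    then have "\<forall>y\<in>body T. y \<restriction> N = x \<restriction> N \<longrightarrow> (\<exists>n\<ge>N. y n < f (x \<restriction> N) (y \<restriction> n))"
      using spec[OF f, of "x \<restriction> N"] by simp
    then have "\<exists>n\<ge>N. x n < f (x \<restriction> N) (x \<restriction> n)" using x(1) by simp
    then obtain n where n: "n \<ge> N" "x n < f (x \<restriction> N) (x \<restriction> n)" by (elim exE conjE)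
    have "f (take N (x \<restriction> n)) (x \<restriction> n) \<le> g (x \<restriction> n)"
      unfolding g_def by (rule member_le_sum) (use n(1) in simp_all)
    then show False using N[OF n(1)] n by (simp add: take_restr)
  qed
  moreover have "\<exists>u\<in>H. \<exists>k>m. u = t @ [k]" if "t \<in> H" for t m
  proof (rule ccontr)
    assume no: "\<not> (\<exists>u\<in>H. \<exists>k>m. u = t @ [k])"
    have "blocked T t"
    proof (rule blockedI)
      fix k assume "k > m" "t @ [k] \<in> T"
      then show "blocked T (t @ [k])" using no unfolding H_def by blast
    qed
    then show False using that by (simp add: H_def)
  qed
  moreover have "H \<subseteq> T" by (simp add: H_def)
  ultimately show "\<exists>H\<subseteq>T. H \<noteq> {} \<and> (\<forall>t\<in>H. \<forall>m. \<exists>u\<in>H. \<exists>k>m. u = t @ [k])"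
    by (intro exI[of _ H] conjI ballI allI)
next
  assume "\<exists>H\<subseteq>T. H \<noteq> {} \<and> (\<forall>t\<in>H. \<forall>m. \<exists>u\<in>H. \<exists>k>m. u = t @ [k])"
  then show "strongly_dominating (body T)"
    by (elim exE conjE) (rule Laver_strongly_dominating[OF T])
qed


section \<open>Completeness\<close>

text \<open>The splitting relation \<open>Q\<close> stays abstract. \<open>Laver\<close> lets the
  nodes supplied by the reduction qualify for points of \<open>B\<close>, and \<open>empty\<close>
  handles the points outside \<open>B\<close>.\<close>

lemma Pi11_complete_Tree_space:
  fixes Q :: "nat list \<Rightarrow> nat \<Rightarrow> nat list \<Rightarrow> bool"
  assumes iff: "\<And>T. T \<in> Tree \<Longrightarrow>
      \<not> P T \<longleftrightarrow> (\<exists>H\<subseteq>T. H \<noteq> {} \<and> (\<forall>t\<in>H. \<forall>m. \<exists>u\<in>H. Q t m u))"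
    and Laver: "\<And>t m k. k > m \<Longrightarrow> Q t m (t @ [k])"
    and empty: "\<And>T. body T = {} \<Longrightarrow> P T"
  shows "Pi11_complete TYPE('b) Tree_space {T \<in> Tree. P T}"
proof -
  have compl: "topspace Tree_space - {T \<in> Tree. P T} = {T \<in> Tree. \<not> P T}"
    unfolding topspace_Tree_space by blast
  have "{T \<in> Tree. \<not> P T} =
      {T \<in> Tree. \<exists>H\<subseteq>T. H \<noteq> {} \<and> (\<forall>t\<in>H. \<forall>m. \<exists>u\<in>H. Q t m u)}"
    by (rule Collect_cong, rule conj_cong[OF refl], rule iff)
  then have an: "analytic_in Tree_space {T \<in> Tree. \<not> P T}"
    using analytic_in_Tree_space[of Q] by (simp only:)
  have "Borel_reducible Y B Tree_space {T \<in> Tree. \<not> P T}"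
    if Y: "Polish_space Y" and BY: "B \<subseteq> topspace Y" and B: "analytic_in Y B" for Y :: "'b topology" and B
  proof -
    obtain f where f: "f \<in> borel_of Y \<rightarrow>\<^sub>M borel_of Tree_space"
      and out: "\<forall>y. y \<notin> B \<longrightarrow> body (f y) = {}"
      and inn: "\<forall>y\<in>B. \<exists>H\<subseteq>f y. H \<noteq> {} \<and> (\<forall>t\<in>H. \<forall>m. \<exists>k>m. t @ [k] \<in> H)"
      using Y B by (rule analytic_in_reduction)
    have tree: "f y \<in> Tree" if "y \<in> topspace Y" for y
      using measurable_space[OF f, of y] that by simp
    have "\<not> P (f y) \<longleftrightarrow> y \<in> B" if y: "y \<in> topspace Y" for y
    proof (cases "y \<in> B")
      case False
      then have "P (f y)" using out by (intro empty) simp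
      then show ?thesis using False by simp
    next
      case True
      with inn have "\<exists>H\<subseteq>f y. H \<noteq> {} \<and> (\<forall>t\<in>H. \<forall>m. \<exists>k>m. t @ [k] \<in> H)" by (rule bspec)
      then obtain H where H: "H \<subseteq> f y" "H \<noteq> {}" "\<forall>t\<in>H. \<forall>m. \<exists>k>m. t @ [k] \<in> H"
        by (elim exE conjE)
      have "\<exists>u\<in>H. Q t m u" if t: "t \<in> H" for t m
      proof -
        obtain k where "k > m" "t @ [k] \<in> H" using H(3) t by blast
        then show ?thesis using Laver by (intro bexI[of _ "t @ [k]"])
      qed
      then have "\<exists>H\<subseteq>f y. H \<noteq> {} \<and> (\<forall>t\<in>H. \<forall>m. \<exists>u\<in>H. Q t m u)"
        using H(1,2) by (intro exI[of _ H] conjI ballI allI)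
      then show ?thesis using True iff[OF tree[OF y]] by simp
    qed
    then have mem: "y \<in> f -` {T \<in> Tree. \<not> P T} \<longleftrightarrow> y \<in> B" if "y \<in> topspace Y" for y
      using tree[OF that] that by simp
    have "f -` {T \<in> Tree. \<not> P T} \<inter> topspace Y = B"
    proof (intro subset_antisym subsetI)
      fix y assume "y \<in> f -` {T \<in> Tree. \<not> P T} \<inter> topspace Y"
      then show "y \<in> B" using mem by (elim IntE) simp
    next
      fix y assume "y \<in> B"
      then show "y \<in> f -` {T \<in> Tree. \<not> P T} \<inter> topspace Y"
        using mem[of y] BY by (intro IntI) (simp_all add: subsetD)
    qed
    with f show ?thesis unfolding Borel_reducible_def by (intro exI[of _ f] conjI)
  qed
  then have "\<forall>(Y :: 'b topology) B. Polish_space Y \<and> B \<subseteq> topspace Y \<and> analytic_in Y B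
      \<longrightarrow> Borel_reducible Y B Tree_space {T \<in> Tree. \<not> P T}"
    by simp
  with Polish_Tree_space an
  have "Sigma11_complete TYPE('b) Tree_space {T \<in> Tree. \<not> P T}"
    unfolding Sigma11_complete_def topspace_Tree_space by (intro conjI Collect_subset)
  then show ?thesis
    unfolding Pi11_complete_def compl by (intro conjI) auto
qed

theorem corollary3p6:
  shows "Pi11_complete TYPE('b) Tree_space {T \<in> Tree. sigma_compact (body T)} \<and>
         Pi11_complete TYPE('b) Tree_space {T \<in> Tree. \<not> strongly_dominating (body T)}"
proof
  show "Pi11_complete TYPE('b) Tree_space {T \<in> Tree. sigma_compact (body T)}"
  proof (rule Pi11_complete_Tree_space)
    \<comment> \<open>Superperfect splitting: \<open>u\<close> may lie arbitrarily far beyond a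
      successor of \<open>t\<close>.\<close>
    show "\<not> sigma_compact (body T) \<longleftrightarrow>
        (\<exists>H\<subseteq>T. H \<noteq> {} \<and> (\<forall>t\<in>H. \<forall>m. \<exists>u\<in>H. \<exists>k>m. prefix (t @ [k]) u))" if "T \<in> Tree" for T
      using that by (rule not_sigma_compact_iff)
    show "\<exists>k'>m. prefix (t @ [k']) (t @ [k])" if "k > m" for t and m k :: nat
      using that by (intro exI[of _ k]) simp
    show "sigma_compact (body T)" if "body T = {}" for T
      using that by (simp add: sigma_compact_empty)
  qed
  show "Pi11_complete TYPE('b) Tree_space {T \<in> Tree. \<not> strongly_dominating (body T)}"
  proof (rule Pi11_complete_Tree_space)
    \<comment> \<open>Laver splitting: \<open>u\<close> has to be an immediate successor of
      \<open>t\<close>.\<close>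
    show "\<not> \<not> strongly_dominating (body T) \<longleftrightarrow>
        (\<exists>H\<subseteq>T. H \<noteq> {} \<and> (\<forall>t\<in>H. \<forall>m. \<exists>u\<in>H. \<exists>k>m. u = t @ [k]))" if "T \<in> Tree" for T
      using strongly_dominating_iff[OF that] by simp
    show "\<exists>k'>m. t @ [k] = t @ [k']" if "k > m" for t and m k :: nat
      using that by (intro exI[of _ k]) simp
    show "\<not> strongly_dominating (body T)" if "body T = {}" for T
      using that by (simp add: strongly_dominating_def)
  qed
qed

end
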